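(* Let $x,h,y\in\mathbb{R}$. If $x\neq0$ and $h\neq0,1$, the sequences $a\in\mathcal{S}(\mathbb{R})$ fixed by the operator $I^{(x)}\circ L^{(h,y)}$ are those whose ordinary generating function is $$\sum_{n\ge0}a_nt^n=\frac{1}{1+\left(\frac{x+y}{h-1}\right)t}.$$ If $x\neq0$, $h=1$ and $x+y=0$, the sequences fixed by $I^{(x)}\circ L^{(1,y)}$ are those whose ordinary generating function is of the form $\frac{1}{1-ct}$ with $c\in\mathbb{R}$.
   Context: $\mathcal{S}(\mathbb{R})$ denotes the set of real sequences $a=(a_n)_{n\ge0}$ with $a_0=1$. For $h,y\in\mathbb{R}$, $L^{(h,y)}$ maps $a$ to $b$ with $b_n=\sum_{i=0}^n\binom{n}{i}h^iy^{n-i}a_i$ (convention $0^0=1$). For $x\in\mathbb{R}$, the interpolated invert operator $I^{(x)}$ maps $a$ with ordinary generating function $\mathbf{A}(t)=\sum_n a_nt^n$ to the sequence with ordinary generating function $\frac{\mathbf{A}(t)}{1-xt\mathbf{A}(t)}$. Composition: $(I^{(x)}\circ L^{(h,y)})(a)=I^{(x)}(L^{(h,y)}(a))$.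
   Formalization: For h = -1 only the claim that the sequence with the stated generating function is fixed is kept; that it is the only one is false there (for y = 0, 1/(1-(x/2)t+t^2) is also fixed), so h ≠ -1 is added for that direction. *)

theory Defs
  imports "HOL-Computational_Algebra.Formal_Power_Series"
begin

definition seqs_one :: "(nat \<Rightarrow> real) set" where
  "seqs_one = {a. a 0 = 1}"

definition binomial_interp :: "real \<Rightarrow> real \<Rightarrow> (nat \<Rightarrow> real) \<Rightarrow> (nat \<Rightarrow> real)" where
  "binomial_interp h y a = (\<lambda>n. \<Sum>i\<le>n. real (n choose i) * h ^ i * y ^ (n - i) * a i)"

abbreviation ogf :: "(nat \<Rightarrow> real) \<Rightarrow> real fps" where
  "ogf a \<equiv> Abs_fps a"

(* The divisor has constant coefficient 1, so this is genuine division of power series. *)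
definition invert_interp :: "real \<Rightarrow> (nat \<Rightarrow> real) \<Rightarrow> (nat \<Rightarrow> real)" where
  "invert_interp x a = fps_nth (ogf a / (1 - fps_const x * fps_X * ogf a))"

definition fixed_seqs :: "((nat \<Rightarrow> real) \<Rightarrow> (nat \<Rightarrow> real)) \<Rightarrow> (nat \<Rightarrow> real) set" where
  "fixed_seqs T = {a \<in> seqs_one. T a = a}"

(* For h = -1 the fixed sequence is not unique; here is another one, for y = 0 and any x. *)
lemma fixed_seqs_minus_one_not_unique:
  fixes x :: real
  defines "a \<equiv> fps_nth (1 / (1 - fps_const (x / 2) * fps_X + fps_X ^ 2))"
  shows "a \<in> fixed_seqs (invert_interp x \<circ> binomial_interp (-1) 0)"
    and "ogf a \<noteq> 1 / (1 + fps_const ((x + 0) / (-1 - 1)) * fps_X)"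
proof -
  define P :: "real fps" where "P = 1 - fps_const (x / 2) * fps_X + fps_X ^ 2"
  define Q :: "real fps" where "Q = 1 + fps_const (x / 2) * fps_X + fps_X ^ 2"
  have P0: "fps_nth P 0 = 1" and Q0: "fps_nth Q 0 = 1"
    by (simp_all add: P_def Q_def power2_eq_square)
  have A: "ogf a = inverse P"
    unfolding a_def P_def[symmetric] by (simp add: fps_divide_unit P0 fps_nth_inverse)
  have a0: "a 0 = 1"
    using arg_cong[OF A, of "\<lambda>f. fps_nth f 0"] P0 by simp
  have Qc: "P oo (- fps_X) = Q"
    by (simp add: P_def Q_def power2_eq_square fps_compose_add_distrib fps_compose_sub_distrib
        fps_compose_mult_distrib)
  have b: "binomial_interp (-1) 0 a n = (-1) ^ n * a n" for n
  proof -
    have "binomial_interp (-1) 0 a n = (\<Sum>i\<le>n. if i = n then (-1) ^ n * a n else 0)"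
      unfolding binomial_interp_def by (intro sum.cong) auto
    then show ?thesis by simp
  qed
  have "ogf (binomial_interp (-1) 0 a) = ogf a oo (- fps_X)"
    by (rule fps_ext) (simp add: b fps_compose_uminus')
  also have "\<dots> = inverse Q"
    by (simp add: A P0 Qc[symmetric] fps_inverse_compose)
  finally have B: "ogf (binomial_interp (-1) 0 a) = inverse Q" .
  have QP: "Q - fps_const x * fps_X = P"
    by (rule fps_ext) (auto simp: P_def Q_def fps_X_def)
  have QQ: "inverse Q * Q = 1"
    by (rule inverse_mult_eq_1) (simp add: Q0)
  have QQ': "inverse Q * (inverse P * Q) = inverse P"
    using QQ by (simp add: mult.left_commute)
  have "1 - fps_const x * fps_X * inverse Q = P * inverse Q"
    unfolding QP[symmetric] using QQ by (simp add: algebra_simps)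
  then have "inverse Q / (1 - fps_const x * fps_X * inverse Q) = inverse Q / (P * inverse Q)"
    by simp
  also have "\<dots> = inverse P"
    using P0 Q0 by (simp add: fps_divide_unit fps_inverse_mult QQ' mult.assoc)
  finally have "invert_interp x (binomial_interp (-1) 0 a) = a"
    by (simp add: invert_interp_def B A[symmetric] fun_eq_iff)
  then show "a \<in> fixed_seqs (invert_interp x \<circ> binomial_interp (-1) 0)"
    by (simp add: fixed_seqs_def seqs_one_def a0)
  define R :: "real fps" where "R = 1 + fps_const ((x + 0) / (-1 - 1)) * fps_X"
  have R0: "fps_nth R 0 = 1" by (simp add: R_def)
  have "fps_nth P 2 \<noteq> fps_nth R 2"
    by (simp add: P_def R_def)
  then have "P \<noteq> R" by auto
  then show "ogf a \<noteq> 1 / (1 + fps_const ((x + 0) / (-1 - 1)) * fps_X)"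
    unfolding R_def[symmetric] A using P0 R0
    by (metis fps_divide_unit fps_inverse_idempotent mult_1 zero_neq_one)
qed

end

theory Submission imports Defs begin

text \<open>
  With B the generating function of the binomial transform of a, the fixed point equation reads
  A = B + x t A B. For the geometric sequences with ratios c and d = h c + y this is c = d + x.
  Uniqueness is a comparison of coefficients. The coefficient at t^n involves a n only through
  (1 - h^n) * a n, so if h is not 1 or -1 the sequence is determined by a 0. If h = 1, the term a n
  cancels, and the coefficient at t^(n + 1) involves a n through ((n + 1) y + 2 x) * a n, which is
  (n - 1) y * a n when x = - y; so a is determined by a 0 and a 1.
\<close>

lemma binomial_interp_power: "binomial_interp h y (\<lambda>n. c ^ n) = (\<lambda>n. (h * c + y) ^ n)"
proof
  fix n
  show "binomial_interp h y (\<lambda>n. c ^ n) n = (h * c + y) ^ n"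
    unfolding binomial_interp_def binomial_ring
    by (intro sum.cong) (simp_all add: power_mult_distrib)
qed

lemma binomial_interp_0 [simp]: "binomial_interp h y a 0 = a 0"
  by (simp add: binomial_interp_def)

text \<open>Only the top term \<open>i = n\<close> survives in the difference, and there the
  binomial coefficient and the power of \<open>y\<close> are both 1.\<close>

lemma binomial_interp_diff:
  assumes "\<And>i. i < n \<Longrightarrow> a i = a' i"
  shows "binomial_interp h y a n - binomial_interp h y a' n = h ^ n * (a n - a' n)"
proof -
  have "(\<Sum>i<n. real (n choose i) * h ^ i * y ^ (n - i) * a i)
      = (\<Sum>i<n. real (n choose i) * h ^ i * y ^ (n - i) * a' i)"
    using assms by (intro sum.cong) auto
  then show ?thesis
    by (simp add: binomial_interp_def lessThan_Suc_atMost[symmetric] algebra_simps)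
qed

text \<open>One index further up, the two top terms survive; the lower one carries
  \<open>Suc n choose n\<close> and a single factor \<open>y\<close>.\<close>

lemma binomial_interp_diff_Suc:
  assumes "\<And>i. i < n \<Longrightarrow> a i = a' i"
  shows "binomial_interp h y a (Suc n) - binomial_interp h y a' (Suc n)
      = h ^ Suc n * (a (Suc n) - a' (Suc n)) + real (Suc n) * h ^ n * y * (a n - a' n)"
proof -
  have "(\<Sum>i<n. real (Suc n choose i) * h ^ i * y ^ (Suc n - i) * a i)
      = (\<Sum>i<n. real (Suc n choose i) * h ^ i * y ^ (Suc n - i) * a' i)"
    using assms by (intro sum.cong) auto
  then show ?thesis
    by (simp add: binomial_interp_def lessThan_Suc_atMost[symmetric] algebra_simps
        del: binomial_Suc_Suc)
qed

lemma binomial_interp_cong: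
  assumes "\<And>i. i \<le> n \<Longrightarrow> a i = a' i"
  shows "binomial_interp h y a n = binomial_interp h y a' n"
  using binomial_interp_diff[of n a a' h y] assms by simp

text \<open>The denominator has constant coefficient 1, hence is a unit, and can be cleared. The
  resulting equation has no division, so its coefficients are plain convolutions.\<close>

lemma invert_interp_eq_iff_fps:
  "invert_interp x b = a \<longleftrightarrow> ogf a = ogf b + fps_const x * fps_X * ogf a * ogf b"
proof -
  define U where "U = 1 - fps_const x * fps_X * ogf b"
  have U0: "fps_nth U 0 \<noteq> 0" by (simp add: U_def)
  have "invert_interp x b = a \<longleftrightarrow> ogf b / U = ogf a"
    by (auto simp: invert_interp_def U_def fps_eq_iff fun_eq_iff)
  also have "\<dots> \<longleftrightarrow> ogf b = ogf a * U"
  proof -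
    have "ogf b * inverse U * U = ogf b" "ogf a * U * inverse U = ogf a"
      using inverse_mult_eq_1[OF U0] inverse_mult_eq_1'[OF U0] by (simp_all add: mult.assoc)
    then show ?thesis
      unfolding fps_divide_unit[OF U0] by metis
  qed
  also have "\<dots> \<longleftrightarrow> ogf a = ogf b + fps_const x * fps_X * ogf a * ogf b"
    by (auto simp: U_def algebra_simps)
  finally show ?thesis .
qed

lemma invert_interp_eq_Suc:
  assumes "invert_interp x b = a"
  shows "a (Suc n) = b (Suc n) + x * (\<Sum>i\<le>n. a i * b (n - i))"
proof -
  have "ogf a = ogf b + fps_const x * (fps_X * (ogf a * ogf b))"
    using assms by (simp add: invert_interp_eq_iff_fps mult.assoc)
  from arg_cong[OF this, of "\<lambda>f. fps_nth f (Suc n)"] show ?thesis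
    by (simp add: fps_mult_nth[of "ogf a" "ogf b"] atLeast0AtMost)
qed

lemma ogf_power_mult: "ogf (\<lambda>n. c ^ n) * (1 - fps_const c * fps_X) = 1"
proof (rule fps_ext)
  fix n
  have "ogf (\<lambda>n. c ^ n) * (1 - fps_const c * fps_X)
      = ogf (\<lambda>n. c ^ n) - fps_const c * (fps_X * ogf (\<lambda>n. c ^ n))"
    by (simp add: algebra_simps)
  then show "fps_nth (ogf (\<lambda>n. c ^ n) * (1 - fps_const c * fps_X)) n = fps_nth 1 n"
    by (cases n) simp_all
qed

lemma ogf_eq_geometric_iff: "ogf a = 1 / (1 - fps_const c * fps_X) \<longleftrightarrow> a = (\<lambda>n. c ^ n)"
proof -
  have "inverse (1 - fps_const c * fps_X) = ogf (\<lambda>n. c ^ n)"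
    by (rule fps_inverse_unique) (metis ogf_power_mult mult.commute)
  then show ?thesis
    by (auto simp: fps_divide_unit fps_eq_iff)
qed

lemma invert_interp_power:
  assumes "c = d + x"
  shows "invert_interp x (\<lambda>n. d ^ n) = (\<lambda>n. c ^ n)"
proof -
  let ?A = "ogf (\<lambda>n. c ^ n)" and ?B = "ogf (\<lambda>n. d ^ n)"
  \<comment> \<open>Insert 1 = B (1 - d t), then rewrite 1 - d t as (1 - c t) + x t; the factor 1 -
    c t absorbs A.\<close>
  have "?A = ?A * (?B * (1 - fps_const d * fps_X))"
    by (simp add: ogf_power_mult)
  also have "\<dots> = ?B * (?A * (1 - fps_const c * fps_X)) + fps_const x * fps_X * ?A * ?B"
    unfolding assms fps_const_add[symmetric] by (simp add: algebra_simps del: fps_const_add)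
  also have "\<dots> = ?B + fps_const x * fps_X * ?A * ?B"
    by (simp add: ogf_power_mult)
  finally show ?thesis
    by (simp add: invert_interp_eq_iff_fps)
qed

lemma power_in_fixed_seqs:
  assumes "c = h * c + y + x"
  shows "(\<lambda>n. c ^ n) \<in> fixed_seqs (invert_interp x \<circ> binomial_interp h y)"
  using invert_interp_power[OF assms]
  by (simp add: fixed_seqs_def seqs_one_def binomial_interp_power)

lemma fixed_seqs_Suc:
  assumes "a \<in> fixed_seqs (invert_interp x \<circ> binomial_interp h y)"
  shows "a (Suc n) = binomial_interp h y a (Suc n)
           + x * (\<Sum>i\<le>n. a i * binomial_interp h y a (n - i))"
  using assms by (intro invert_interp_eq_Suc) (simp add: fixed_seqs_def)

lemma fixed_seqs_0:
  assumes "a \<in> fixed_seqs T"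
  shows "a 0 = 1"
  using assms by (simp add: fixed_seqs_def seqs_one_def)

lemma fixed_seqs_unique:
  assumes a: "a \<in> fixed_seqs (invert_interp x \<circ> binomial_interp h y)"
    and a': "a' \<in> fixed_seqs (invert_interp x \<circ> binomial_interp h y)"
    and h: "h \<noteq> 1" "h \<noteq> -1"
  shows "a = a'"
proof
  fix n
  show "a n = a' n"
  proof (induction n rule: less_induct)
    case (less n)
    show ?case
    proof (cases n)
      case 0
      then show ?thesis using a a' by (simp add: fixed_seqs_0)
    next
      case (Suc m)
      let ?L = "binomial_interp h y"
      \<comment> \<open>All indices here are at most \<open>m < n\<close>, so the induction
        hypothesis covers the whole convolution.\<close>
      have "(\<Sum>i\<le>m. a i * ?L a (m - i)) = (\<Sum>i\<le>m. a' i * ?L a' (m - i))"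
        using less Suc by (intro sum.cong refl arg_cong2[of _ _ _ _ "(*)"] binomial_interp_cong) auto
      then have "a n - a' n = ?L a n - ?L a' n"
        using fixed_seqs_Suc[OF a, of m] fixed_seqs_Suc[OF a', of m] Suc by simp
      also have "\<dots> = h ^ n * (a n - a' n)"
        by (rule binomial_interp_diff) (rule less)
      finally have "(1 - h ^ n) * (a n - a' n) = 0"
        by (simp add: algebra_simps)
      \<comment> \<open>The only real roots of unity are 1 and -1, and \<open>n\<close> is
        positive.\<close>
      moreover have "h ^ n \<noteq> 1"
      proof
        assume "h ^ n = 1"
        then have "\<bar>h\<bar> ^ n = 1" by (simp add: power_abs[symmetric])
        then have "\<bar>h\<bar> = 1" using Suc power_eq_1_iff[of "\<bar>h\<bar>" n] by simp
        then show False using h by linarith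
      qed
      ultimately show ?thesis by simp
    qed
  qed
qed

lemma fixed_seqs_unique_1:
  assumes a: "a \<in> fixed_seqs (invert_interp x \<circ> binomial_interp 1 y)"
    and a': "a' \<in> fixed_seqs (invert_interp x \<circ> binomial_interp 1 y)"
    and xy: "x \<noteq> 0" "x + y = 0"
    and one: "a 1 = a' 1"
  shows "a = a'"
proof
  fix n
  show "a n = a' n"
  proof (induction n rule: less_induct)
    case (less n)
    \<comment> \<open>The factor \<open>n - 1\<close> reached below vanishes at
      \<open>n = 1\<close>; there the value is the free parameter of the family.\<close>
    consider "n = 0" | "n = 1" | m where "n = Suc (Suc m)"
      by (metis One_nat_def not0_implies_Suc)
    then show ?case
    proof cases
      case 1
      then show ?thesis using a a' by (simp add: fixed_seqs_0)
    next
      case 2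
      then show ?thesis using one by simp
    next
      case (3 m)
      let ?L = "binomial_interp 1 y"
      let ?S = "\<lambda>a. \<Sum>i\<le>m. a (Suc i) * ?L a (Suc m - i)"
      \<comment> \<open>Both end terms are split off, since they alone involve \<open>a n\<close>;
        in \<open>?S\<close> all indices lie between 1 and \<open>n - 1\<close>.\<close>
      have conv: "(\<Sum>i\<le>n. a i * ?L a (n - i)) = a 0 * ?L a n + ?S a + a n * a 0" for a
        unfolding 3 sum.atMost_Suc_shift[of _ "Suc m"] by simp
      have "?S a = ?S a'"
        using less 3 by (intro sum.cong refl arg_cong2[of _ _ _ _ "(*)"] binomial_interp_cong) auto
      then have "(a (Suc n) - a' (Suc n)) - (?L a (Suc n) - ?L a' (Suc n))
          = x * ((?L a n - ?L a' n) + (a n - a' n))"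
        using fixed_seqs_Suc[OF a, of n] fixed_seqs_Suc[OF a', of n]
        unfolding conv by (simp add: fixed_seqs_0[OF a] fixed_seqs_0[OF a'] algebra_simps)
      moreover have "?L a n - ?L a' n = a n - a' n"
        using binomial_interp_diff[of n a a' 1 y] less by simp
      moreover have "?L a (Suc n) - ?L a' (Suc n)
          = (a (Suc n) - a' (Suc n)) + real (Suc n) * y * (a n - a' n)"
        using binomial_interp_diff_Suc[of n a a' 1 y] less by simp
      \<comment> \<open>Because \<open>h = 1\<close>, the differences at \<open>Suc n\<close>
        cancel, which leaves a linear equation in \<open>a n - a' n\<close> alone.\<close>
      ultimately have "x * (2 * (a n - a' n)) + real (Suc n) * y * (a n - a' n) = 0"
        by simp
      moreover have "y = - x" using xy by simp
      ultimately have "(real n - 1) * x * (a n - a' n) = 0"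
        by (simp add: algebra_simps)
      then show ?thesis using xy 3 by simp
    qed
  qed
qed

text \<open>Equality excludes \<open>h = -1\<close>, because
  \<open>fixed_seqs_minus_one_not_unique\<close> exhibits a second fixed sequence there for
  \<open>y = 0\<close>.\<close>

theorem theorem7:
  fixes x h y :: real
  shows
    "(x \<noteq> 0 \<and> h \<noteq> 0 \<and> h \<noteq> 1 \<longrightarrow>
        {a \<in> seqs_one. ogf a = 1 / (1 + fps_const ((x + y) / (h - 1)) * fps_X)}
          \<subseteq> fixed_seqs (invert_interp x \<circ> binomial_interp h y)
      \<and> (h \<noteq> -1 \<longrightarrow>
          fixed_seqs (invert_interp x \<circ> binomial_interp h y)
            = {a \<in> seqs_one. ogf a = 1 / (1 + fps_const ((x + y) / (h - 1)) * fps_X)}))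
   \<and> (x \<noteq> 0 \<and> h = 1 \<and> x + y = 0 \<longrightarrow>
        fixed_seqs (invert_interp x \<circ> binomial_interp 1 y)
          = {a \<in> seqs_one. \<exists>c :: real. ogf a = 1 / (1 - fps_const c * fps_X)})"
proof (intro conjI impI; elim conjE)
  \<comment> \<open>The ratio of the geometric sequence, which is the solution of
    \<open>c = h * c + y + x\<close>.\<close>
  define c where "c = - ((x + y) / (h - 1))"
  have geo: "{a \<in> seqs_one. ogf a = 1 / (1 + fps_const ((x + y) / (h - 1)) * fps_X)}
      = {\<lambda>n. c ^ n}"
  proof -
    have "1 + fps_const ((x + y) / (h - 1)) * fps_X = 1 - fps_const c * fps_X"
      by (simp add: c_def flip: fps_const_neg)
    then show ?thesis by (auto simp: ogf_eq_geometric_iff seqs_one_def)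
  qed
  assume "h \<noteq> 1"
  then have "c = h * c + y + x" by (simp add: c_def field_simps)
  then have fixed: "(\<lambda>n. c ^ n) \<in> fixed_seqs (invert_interp x \<circ> binomial_interp h y)"
    by (rule power_in_fixed_seqs)
  then show "{a \<in> seqs_one. ogf a = 1 / (1 + fps_const ((x + y) / (h - 1)) * fps_X)}
      \<subseteq> fixed_seqs (invert_interp x \<circ> binomial_interp h y)"
    unfolding geo by simp
  assume "h \<noteq> -1"
  then show "fixed_seqs (invert_interp x \<circ> binomial_interp h y)
      = {a \<in> seqs_one. ogf a = 1 / (1 + fps_const ((x + y) / (h - 1)) * fps_X)}"
    unfolding geo using fixed fixed_seqs_unique \<open>h \<noteq> 1\<close> by blast
next
  assume xy: "x \<noteq> 0" "x + y = 0"
  have fixed: "(\<lambda>n. c ^ n) \<in> fixed_seqs (invert_interp x \<circ> binomial_interp 1 y)" for c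
    using xy by (intro power_in_fixed_seqs) simp
  \<comment> \<open>The geometric sequence of ratio \<open>a 1\<close> is fixed as well and agrees
    with \<open>a\<close> at index 1.\<close>
  have "a = (\<lambda>n. a 1 ^ n)"
    if "a \<in> fixed_seqs (invert_interp x \<circ> binomial_interp 1 y)" for a
    using that fixed xy by (rule fixed_seqs_unique_1) simp
  then show "fixed_seqs (invert_interp x \<circ> binomial_interp 1 y)
      = {a \<in> seqs_one. \<exists>c :: real. ogf a = 1 / (1 - fps_const c * fps_X)}"
    using fixed unfolding ogf_eq_geometric_iff by (fastforce simp: fixed_seqs_def)
qed

end
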